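(* Let $0\le\alpha<1$ and let $h(z)=z+\sum_{n=2}^{\infty}a_nz^n$ and $g(z)=\sum_{n=1}^{\infty}b_nz^n$ be power series whose coefficients satisfy (with $a_1=1$) $$|a_n|\le\left(\frac{n+1}{2}\right)^2\quad\text{and}\quad |b_n|\le\left(\frac{n-1}{2}\right)^2\qquad\text{for all } n\ge1.$$ Then $f=h+\overline{g}$ is univalent and fully starlike of order $\alpha$ in the disk $|z|<r_0$, where $r_0=r_0(\alpha)$ is the real root of the equation $$2(1-\alpha)(1-r)^4+\alpha(1-r)^2-(r^2+r+1)=0$$ in the interval $(0,1)$. In particular, $f$ is univalent and fully starlike in $|z|<r_0$, where $r_0=r_0(0)\approx0.129831$ is the root in $(0,1)$ of the equation $2r^4-8r^3+11r^2-9r+1=0$. Moreover, the result is sharp for each $\alpha\in[0,1)$: for each such $\alpha$, $r_0(\alpha)$ cannot be replaced by any larger number.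
   Context: A complex-valued harmonic function $f$ with $f(0)=0$ is said to be fully starlike of order $\alpha$ ($0\le\alpha<1$) in a disk $|z|<\rho$ if, for every $0<r<\rho$, $f$ maps the circle $|z|=r$ in a one-to-one manner onto a curve that bounds a domain starlike with respect to the origin and satisfies $\frac{\partial}{\partial\theta}\arg f(re^{i\theta})>\alpha$ for $0\le\theta\le2\pi$. Fully starlike means fully starlike of order $0$. *)

theory Defs
  imports "HOL-Analysis.Analysis"
begin

text \<open>
  Complex-valued harmonic functions: twice continuously differentiable in the real sense, with
  vanishing Laplacian. The witnesses \<open>fx\<close>, \<open>fy\<close>, \<open>fxx\<close>, \dots are the partial derivatives with
  respect to \<open>x = Re z\<close> and \<open>y = Im z\<close>.
\<close>

definition harmonic_complex_on :: "(complex \<Rightarrow> complex) \<Rightarrow> complex set \<Rightarrow> bool" where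
  "harmonic_complex_on f S \<longleftrightarrow> open S \<and>
     (\<exists>fx fy fxx fxy fyx fyy :: complex \<Rightarrow> complex.
        (\<forall>z\<in>S. (f has_derivative (\<lambda>v. Re v *\<^sub>R fx z + Im v *\<^sub>R fy z)) (at z)) \<and>
        (\<forall>z\<in>S. (fx has_derivative (\<lambda>v. Re v *\<^sub>R fxx z + Im v *\<^sub>R fxy z)) (at z)) \<and>
        (\<forall>z\<in>S. (fy has_derivative (\<lambda>v. Re v *\<^sub>R fyx z + Im v *\<^sub>R fyy z)) (at z)) \<and>
        continuous_on S fxx \<and> continuous_on S fxy \<and>
        continuous_on S fyx \<and> continuous_on S fyy \<and>
        (\<forall>z\<in>S. fxx z + fyy z = 0))"

text \<open>
  The library predicate \<^const>\<open>starlike\<close> leaves the centre existential; here it is the origin.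
\<close>

definition starlike_domain_0 :: "complex set \<Rightarrow> bool" where
  "starlike_domain_0 D \<longleftrightarrow>
     open D \<and> connected D \<and> 0 \<in> D \<and> (\<forall>w\<in>D. closed_segment 0 w \<subseteq> D)"

text \<open>
  \<open>\<phi>\<close> is a branch of \<open>arg f(r e\<^sup>i\<^sup>\<theta>)\<close> along the circle. It is taken on all of the real line, not
  just on \<open>[0, 2\<pi>]\<close>, so that derivatives at the endpoints are two-sided; it need not be periodic.
\<close>

definition arg_branch_on_circle :: "(complex \<Rightarrow> complex) \<Rightarrow> real \<Rightarrow> (real \<Rightarrow> real) \<Rightarrow> bool" where
  "arg_branch_on_circle f r \<phi> \<longleftrightarrow>
     continuous_on UNIV \<phi> \<and>
     (\<forall>\<theta>. f (of_real r * exp (\<i> * of_real \<theta>)) \<noteq> 0 \<and>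
          is_Arg (f (of_real r * exp (\<i> * of_real \<theta>))) (\<phi> \<theta>))"

definition fully_starlike_of_order :: "real \<Rightarrow> (complex \<Rightarrow> complex) \<Rightarrow> real \<Rightarrow> bool" where
  "fully_starlike_of_order \<alpha> f \<rho> \<longleftrightarrow>
     harmonic_complex_on f (ball 0 \<rho>) \<and> f 0 = 0 \<and>
     (\<forall>r. 0 < r \<and> r < \<rho> \<longrightarrow>
        inj_on f (sphere 0 r) \<and>
        (\<exists>D. bounded D \<and> starlike_domain_0 D \<and> frontier D = f ` sphere 0 r) \<and>
        (\<exists>\<phi>. arg_branch_on_circle f r \<phi> \<and>
             (\<forall>\<theta>\<in>{0..2 * pi}. \<exists>d > \<alpha>. (\<phi> has_real_derivative d) (at \<theta>))))"

abbreviation fully_starlike :: "(complex \<Rightarrow> complex) \<Rightarrow> real \<Rightarrow> bool" where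
  "fully_starlike \<equiv> fully_starlike_of_order 0"

text \<open>
  The coefficient bounds. The values \<open>a 0\<close> and \<open>b 0\<close> are irrelevant: the series below never
  use them. Note that the bound for \<open>n = 1\<close> forces \<open>b 1 = 0\<close>.
\<close>

definition coeffs_admissible :: "(nat \<Rightarrow> complex) \<Rightarrow> (nat \<Rightarrow> complex) \<Rightarrow> bool" where
  "coeffs_admissible a b \<longleftrightarrow>
     a 1 = 1 \<and>
     (\<forall>n\<ge>1. cmod (a n) \<le> ((real n + 1) / 2)\<^sup>2) \<and>
     (\<forall>n\<ge>1. cmod (b n) \<le> ((real n - 1) / 2)\<^sup>2)"

definition h_series :: "(nat \<Rightarrow> complex) \<Rightarrow> complex \<Rightarrow> complex" where
  "h_series a z = z + (\<Sum>n. a (n + 2) * z ^ (n + 2))"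

definition g_series :: "(nat \<Rightarrow> complex) \<Rightarrow> complex \<Rightarrow> complex" where
  "g_series b z = (\<Sum>n. b (n + 1) * z ^ (n + 1))"

definition harmonic_map :: "(nat \<Rightarrow> complex) \<Rightarrow> (nat \<Rightarrow> complex) \<Rightarrow> complex \<Rightarrow> complex" where
  "harmonic_map a b z = h_series a z + cnj (g_series b z)"

definition radius_root :: "real \<Rightarrow> real \<Rightarrow> bool" where
  "radius_root \<alpha> r \<longleftrightarrow> 0 < r \<and> r < 1 \<and>
     2 * (1 - \<alpha>) * (1 - r) ^ 4 + \<alpha> * (1 - r)\<^sup>2 - (r\<^sup>2 + r + 1) = 0"

definition r0 :: "real \<Rightarrow> real" where
  "r0 \<alpha> = (THE r. radius_root \<alpha> r)"

end

theory Submission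
  imports Defs
begin

text \<open>
  Since the bound on \<open>b 1\<close> is zero, every admissible map is a perturbation
  \<open>f z = z + p z + cnj (q z)\<close> of the identity by power series starting at degree two. All the geometry
  follows from one majorant inequality,
  \<open>\<Sum>n\<ge>2. ((n - \<alpha>) |a n| + (n + \<alpha>) |b n|) r ^ n < (1 - \<alpha>) r\<close>.

  First, \<open>n (1 - \<alpha>) \<le> n - \<alpha>\<close>, so the inequality makes \<open>f - id\<close> a strict contraction on the disk of
  radius \<open>r\<close> (\<open>small_coeffs.lipschitz\<close>). Hence \<open>f\<close> is injective and \<open>f z / z\<close> has positive real part.

  Secondly, put \<open>A = z h' - cnj (z g')\<close>. The velocity of \<open>\<theta> \<mapsto> f (r exp (\<i> \<theta>))\<close> is \<open>\<i> A\<close>, so the angular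
  speed is \<open>Re (A / f)\<close>; it exceeds \<open>\<alpha>\<close> exactly when \<open>|A - f| < |A + (1 - 2 \<alpha>) f|\<close>. Comparing
  coefficients, twice the majorant controls both sides of this inequality at once
  (\<open>small_coeffs.angular_speed_gt\<close>).

  For starlikeness, the function \<open>\<phi> \<theta> = \<theta> + Im (Ln (f z / z))\<close> with \<open>z = r exp (\<i> \<theta>)\<close> is a branch of
  \<open>arg f\<close> that increases strictly and grows by exactly \<open>2 \<pi>\<close> in each turn. Therefore each ray from the
  origin meets the image of the circle at most once. By invariance of domain the image of the open disk is
  open with that curve as its frontier, and a bounded domain containing the origin whose
  frontier is met at most once by every ray is starlike (\<open>starlike_domain_image_ball\<close>).

  For the given bounds the extreme value of the majorant is a combination of the series of
  \<open>1 / (1 - r) ^ k\<close> with \<open>k \<le> 4\<close>; the inequality becomes positivity of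
  \<open>2 (1 - \<alpha>) (1 - r) ^ 4 + \<alpha> (1 - r)\<^sup>2 - (r\<^sup>2 + r + 1)\<close>, which is strictly decreasing on
  \<open>[0, 1]\<close> and so positive exactly below its root \<open>r0 \<alpha>\<close>. Sharpness comes from the coefficients of
  maximal modulus with signs chosen so that, on the positive real axis, all terms of the
  majorant add up with the same sign: then \<open>A = \<alpha> f\<close> at the point \<open>r0 \<alpha>\<close>, and the angular speed there
  equals \<open>\<alpha>\<close> for every branch of the argument (\<open>not_fully_starlike_extremal\<close>).
\<close>

section \<open>Starlike images of disks\<close>

text \<open>
  If some \<open>w\<close> in the image had a point of the segment from \<open>0\<close> to \<open>w\<close> outside the image, then the ray
  through \<open>w\<close> would cross the frontier once before \<open>w\<close> and, the image being bounded, once more beyond \<open>w\<close>.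
\<close>

lemma starlike_domain_image_ball:
  fixes f :: "complex \<Rightarrow> complex"
  assumes "r > 0" and cont: "continuous_on (cball 0 r) f" and inj: "inj_on f (cball 0 r)"
    and f0: "f 0 = 0"
    and ray: "\<And>z w c. z \<in> sphere 0 r \<Longrightarrow> w \<in> sphere 0 r \<Longrightarrow> c > 0 \<Longrightarrow> f z = c *\<^sub>R f w \<Longrightarrow> z = w"
  shows "bounded (f ` ball 0 r)" "frontier (f ` ball 0 r) = f ` sphere 0 r"
    "starlike_domain_0 (f ` ball 0 r)"
proof -
  define D where "D = f ` ball 0 r"
  have opn: "open D"
    unfolding D_def using invariance_of_domain_ball[OF cont \<open>r > 0\<close> inj] .
  have cmp: "compact (f ` cball 0 r)"
    using cont compact_cball compact_continuous_image by blast
  have sub: "D \<subseteq> f ` cball 0 r" unfolding D_def by (intro image_mono) auto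
  have bdd: "bounded D"
    using bounded_subset[OF compact_imp_bounded[OF cmp] sub] .
  have "closure D = f ` cball 0 r"
  proof
    show "closure D \<subseteq> f ` cball 0 r"
      using closure_minimal[OF sub compact_imp_closed[OF cmp]] .
    show "f ` cball 0 r \<subseteq> closure D"
      using continuous_image_closure_subset[of "cball 0 r" f "ball 0 r"] cont \<open>r > 0\<close>
      by (simp add: D_def)
  qed
  moreover have "f ` cball 0 r - f ` ball 0 r = f ` (cball 0 r - ball 0 r)"
    using inj by (intro inj_on_image_set_diff[symmetric, where C = "cball 0 r"]) auto
  ultimately have fr: "frontier D = f ` sphere 0 r"
    using opn by (simp add: frontier_def interior_open cball_diff_eq_sphere D_def)
  have conn: "connected D"
    unfolding D_def by (intro connected_continuous_image continuous_on_subset[OF cont]) auto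
  have zero: "0 \<in> D" unfolding D_def using f0 \<open>r > 0\<close> by (intro image_eqI[of _ _ 0]) auto
  have seg: "closed_segment 0 w \<subseteq> D" if w: "w \<in> D" for w
  proof
    fix v assume "v \<in> closed_segment 0 w"
    then obtain t where t: "0 \<le> t" "t \<le> 1" "v = t *\<^sub>R w"
      by (auto simp: closed_segment_def)
    show "v \<in> D"
    proof (rule ccontr)
      assume nv: "v \<notin> D"
      then have "w \<noteq> 0" using t zero by auto
      \<comment> \<open>The ray meets the frontier of \<open>D\<close> at or before \<open>v\<close>, and again beyond \<open>w\<close> because \<open>D\<close> is bounded.\<close>
      obtain x where x: "x \<in> closed_segment 0 v" "x \<in> frontier D"
        using connected_Int_frontier[OF connected_segment(1)[of 0 v], of D] zero nv by blast
      then obtain s where s: "0 \<le> s" "s \<le> 1" "x = s *\<^sub>R v"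
        by (auto simp: closed_segment_def)
      obtain B where B: "B > 0" "\<And>y. y \<in> D \<Longrightarrow> norm y \<le> B"
        using bdd by (auto simp: bounded_pos)
      define N where "N = 1 + (B + 1) / norm w"
      have N1: "N > 1" using B \<open>w \<noteq> 0\<close> by (simp add: N_def)
      have "norm (N *\<^sub>R w) = norm w + (B + 1)"
        using B(1) \<open>w \<noteq> 0\<close> N1 by (simp add: N_def field_simps)
      then have out: "N *\<^sub>R w \<notin> D" using B(2)[of "N *\<^sub>R w"] by (smt (verit) norm_ge_zero)
      obtain y where y: "y \<in> closed_segment w (N *\<^sub>R w)" "y \<in> frontier D"
        using connected_Int_frontier[OF connected_segment(1)[of w "N *\<^sub>R w"], of D] w out by blast
      then obtain u where u: "0 \<le> u" "u \<le> 1" "y = (1 - u) *\<^sub>R w + u *\<^sub>R N *\<^sub>R w"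
        by (auto simp: closed_segment_def)
      define p where "p = s * t"
      define q where "q = 1 + u * (N - 1)"
      have x': "x = p *\<^sub>R w" using s t by (simp add: p_def)
      have y': "y = q *\<^sub>R w" using u by (simp add: q_def algebra_simps)
      have disj: "frontier D \<inter> D = {}" using opn by (simp add: frontier_def interior_open Int_commute)
      have "p \<noteq> 0" "p \<noteq> 1" using x' x(2) zero w disj by auto
      then have p: "0 < p" "p < 1"
        using s t mult_le_one[of s t] by (auto simp: p_def less_le)
      have q: "q \<ge> 1" using u N1 by (simp add: q_def)
      obtain a b where ab: "a \<in> sphere 0 r" "x = f a" "b \<in> sphere 0 r" "y = f b"
        using x(2) y(2) fr by auto
      have "y = (q / p) *\<^sub>R x" unfolding x' y' using p by simp
      then have "f b = (q / p) *\<^sub>R f a" using ab by simp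
      then have "b = a" using ray[of b a "q / p"] ab p q by simp
      then have "p *\<^sub>R w = q *\<^sub>R w" using ab x' y' by simp
      then show False using p q \<open>w \<noteq> 0\<close> by simp
    qed
  qed
  show "bounded (f ` ball 0 r)" using bdd by (simp add: D_def)
  show "frontier (f ` ball 0 r) = f ` sphere 0 r" using fr by (simp add: D_def)
  show "starlike_domain_0 (f ` ball 0 r)"
    using opn conn zero seg unfolding starlike_domain_0_def D_def by blast
qed

section \<open>The argument along the image of a circle\<close>

abbreviation circ :: "real \<Rightarrow> real \<Rightarrow> complex" where
  "circ r \<theta> \<equiv> of_real r * exp (\<i> * of_real \<theta>)"

lemma sphere_0_eq_circ:
  assumes "r > 0" "z \<in> sphere 0 r"
  obtains \<theta> where "z = circ r \<theta>"
proof
  show "z = circ r (Arg z)" using Arg_eq[of z] assms by (metis mem_sphere_0 norm_zero order_less_irrefl)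
qed

text \<open>
  Points of the image on a common ray have arguments differing by a multiple of \<open>2 \<pi>\<close>. Quasi-periodicity
  transfers this multiple to the parameter, and monotonicity of \<open>\<phi>\<close> does the rest. The exact increment
  \<open>2 \<pi>\<close> per turn matters: with \<open>4 \<pi>\<close> the curve would wind twice.
\<close>

lemma ray_meets_circle_image_once:
  assumes "r > 0" and br: "arg_branch_on_circle f r \<phi>"
    and per: "\<And>\<theta>. \<phi> (\<theta> + 2 * pi) = \<phi> \<theta> + 2 * pi"
    and mono: "strict_mono \<phi>"
    and "z \<in> sphere 0 r" "w \<in> sphere 0 r" "c > 0" "f z = c *\<^sub>R f w"
  shows "z = w"
proof -
  obtain s where s: "z = circ r s" using sphere_0_eq_circ assms by metis
  obtain t where t: "w = circ r t" using sphere_0_eq_circ assms by metis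
  have nz: "f z \<noteq> 0" "f w \<noteq> 0"
    and arg: "f z = of_real (cmod (f z)) * exp (\<i> * of_real (\<phi> s))" "f w = of_real (cmod (f w)) * exp (\<i> * of_real (\<phi> t))"
    using br s t by (auto simp: arg_branch_on_circle_def is_Arg_def)
  have "cmod (f z) = c * cmod (f w)" using assms by simp
  then have "of_real (c * cmod (f w)) * exp (\<i> * of_real (\<phi> s)) = of_real (c * cmod (f w)) * exp (\<i> * of_real (\<phi> t))"
    using arg \<open>f z = c *\<^sub>R f w\<close> by (metis mult.assoc of_real_mult scaleR_conv_of_real)
  then have "exp (\<i> * complex_of_real (\<phi> s)) = exp (\<i> * of_real (\<phi> t))"
    using nz \<open>c > 0\<close> by simp
  then obtain n :: int where "\<i> * complex_of_real (\<phi> s) = \<i> * of_real (\<phi> t) + (of_int (2 * n) * pi) * \<i>"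
    by (auto simp: exp_eq)
  then have "\<phi> s = \<phi> t + 2 * pi * of_int n"
    by (auto simp: complex_eq_iff algebra_simps)
  moreover have nat_shift: "\<phi> (x + 2 * pi * real m) = \<phi> x + 2 * pi * real m" for x m
  proof (induction m)
    case (Suc m)
    then show ?case using per[of "x + 2 * pi * real m"] by (simp add: algebra_simps)
  qed simp
  have "\<phi> (t + 2 * pi * of_int n) = \<phi> t + 2 * pi * of_int n"
  proof (cases "n \<ge> 0")
    case True
    then show ?thesis using nat_shift[of t "nat n"] by simp
  next
    case False
    then show ?thesis using nat_shift[of "t + 2 * pi * of_int n" "nat (- n)"] by simp
  qed
  ultimately have "\<phi> s = \<phi> (t + 2 * pi * of_int n)" by simp
  then have st: "s = t + 2 * pi * of_int n" using mono strict_mono_eq by blast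
  have "exp (\<i> * complex_of_real s) = exp (\<i> * complex_of_real t)"
    unfolding exp_eq by (rule exI[of _ n]) (simp add: st algebra_simps)
  then show ?thesis using s t by simp
qed

text \<open>
  Rotating \<open>f\<close> back by its own argument gives the real function \<open>|f|\<close>, so the imaginary part of the
  derivative of \<open>exp (- \<i> \<phi>) f\<close> vanishes. Applying to every differentiable branch, the formula
  also serves the sharpness proof, where the branch is arbitrary.
\<close>

lemma arg_branch_speed:
  assumes br: "arg_branch_on_circle f r \<phi>"
    and d: "(\<phi> has_real_derivative d) (at \<theta>)"
    and F: "((\<lambda>t. f (circ r t)) has_vector_derivative F') (at \<theta>)"
  shows "d = Im (F' / f (circ r \<theta>))"
proof -
  let ?F = "\<lambda>t. f (circ r t)"
  let ?e = "\<lambda>t. exp (- \<i> * of_real (\<phi> t)) :: complex"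
  have real: "?e t * ?F t = of_real (cmod (?F t))" for t
  proof -
    have "?F t = of_real (cmod (?F t)) * exp (\<i> * of_real (\<phi> t))"
      using br by (auto simp: arg_branch_on_circle_def is_Arg_def)
    then have "?e t * ?F t = of_real (cmod (?F t)) * (?e t * exp (\<i> * of_real (\<phi> t)))"
      by (metis mult.left_commute)
    then show ?thesis by (simp flip: exp_add)
  qed
  have phi: "((\<lambda>t. complex_of_real (\<phi> t)) has_vector_derivative of_real d) (at \<theta>)"
    using d by (intro has_vector_derivative_of_real) (auto simp: has_real_derivative_iff_has_vector_derivative)
  have "((\<lambda>t. - \<i> * complex_of_real (\<phi> t)) has_vector_derivative - \<i> * of_real d) (at \<theta>)"
    by (intro has_vector_derivative_mult_right phi)
  then have "(?e has_vector_derivative (- \<i> * of_real d) * ?e \<theta>) (at \<theta>)"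
    using field_vector_diff_chain_at[OF _ DERIV_exp] by (fastforce simp: o_def)
  from has_vector_derivative_mult[OF this F]
  have "((\<lambda>t. ?e t * ?F t) has_vector_derivative (?e \<theta> * F' + (- \<i> * of_real d) * ?e \<theta> * ?F \<theta>)) (at \<theta>)" .
  then have "((\<lambda>t. of_real (cmod (?F t)) :: complex) has_vector_derivative
      (?e \<theta> * F' + (- \<i> * of_real d) * ?e \<theta> * ?F \<theta>)) (at \<theta>)"
    unfolding real .
  from bounded_linear.has_vector_derivative[OF bounded_linear_Im this]
  have "((\<lambda>t. 0) has_vector_derivative Im (?e \<theta> * F' + (- \<i> * of_real d) * ?e \<theta> * ?F \<theta>)) (at \<theta>)"
    by simp
  then have im: "Im (?e \<theta> * F' + (- \<i> * of_real d) * ?e \<theta> * ?F \<theta>) = 0"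
    using vector_derivative_unique_at has_vector_derivative_const by blast
  have nz: "?F \<theta> \<noteq> 0" using br by (auto simp: arg_branch_on_circle_def)
  have "?e \<theta> * F' + (- \<i> * of_real d) * ?e \<theta> * ?F \<theta> = (?e \<theta> * ?F \<theta>) * (F' / ?F \<theta> - \<i> * of_real d)"
    using nz by (simp add: field_simps)
  also have "\<dots> = of_real (cmod (?F \<theta>)) * (F' / ?F \<theta> - \<i> * of_real d)" by (simp only: real)
  finally show ?thesis using im nz by simp
qed

text \<open>
  Positivity of \<open>Re (f z / z)\<close> keeps \<open>f z / z\<close> in the domain of the principal logarithm, so \<open>arg f\<close> is
  \<open>\<theta>\<close> plus a correction that is differentiable and \<open>2 \<pi>\<close>-periodic in \<open>\<theta>\<close>. This determines the winding
  number without any homotopy argument.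
\<close>

lemma arg_branch_exists:
  assumes "r > 0"
    and pos: "\<And>z. z \<in> sphere 0 r \<Longrightarrow> Re (f z / z) > 0"
    and F: "\<And>\<theta>. ((\<lambda>t. f (circ r t)) has_vector_derivative F' \<theta>) (at \<theta>)"
  obtains \<phi> where "arg_branch_on_circle f r \<phi>" "\<And>\<theta>. \<phi> (\<theta> + 2 * pi) = \<phi> \<theta> + 2 * pi"
    "\<And>\<theta>. (\<phi> has_real_derivative Im (F' \<theta> / f (circ r \<theta>))) (at \<theta>)"
proof -
  let ?F = "\<lambda>t. f (circ r t)"
  define u where "u t = ?F t / circ r t" for t
  define \<phi> where "\<phi> t = t + Im (Ln (u t))" for t
  have upos: "Re (u t) > 0" for t unfolding u_def using \<open>r > 0\<close> by (intro pos) (simp add: norm_mult)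
  have nz: "circ r t \<noteq> 0" for t using \<open>r > 0\<close> by simp
  have circ: "(circ r has_vector_derivative \<i> * circ r t) (at t)" for t
    by (rule has_vector_derivative_real_field derivative_eq_intros refl | simp)+
  have diff: "\<exists>d. (\<phi> has_real_derivative d) (at t)" for t
  proof -
    have "(circ r has_derivative (\<lambda>x. x *\<^sub>R (\<i> * circ r t))) (at t)"
      "(?F has_derivative (\<lambda>x. x *\<^sub>R F' t)) (at t)"
      using circ[of t] F[of t] by (auto simp: has_vector_derivative_def)
    then have "?F differentiable (at t)" "circ r differentiable (at t)"
      by (auto simp: differentiable_def)
    then have "u differentiable (at t)" unfolding u_def using nz by (intro differentiable_divide)
    then obtain u' where "(u has_vector_derivative u') (at t)"
      using vector_derivative_works by blast
    moreover have "u t \<notin> \<real>\<^sub>\<le>\<^sub>0" using upos[of t] by (auto simp: complex_nonpos_Reals_iff)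
    ultimately have "((Ln \<circ> u) has_vector_derivative u' * inverse (u t)) (at t)"
      using field_vector_diff_chain_at has_field_derivative_Ln by blast
    from bounded_linear.has_vector_derivative[OF bounded_linear_Im this]
    have "((\<lambda>t. Im (Ln (u t))) has_real_derivative Im (u' * inverse (u t))) (at t)"
      by (simp add: has_real_derivative_iff_has_vector_derivative)
    then show ?thesis unfolding \<phi>_def using DERIV_add[OF DERIV_ident] by blast
  qed
  have br: "arg_branch_on_circle f r \<phi>"
    unfolding arg_branch_on_circle_def
  proof (intro conjI allI)
    show "continuous_on UNIV \<phi>"
      using diff DERIV_isCont by (auto simp: continuous_on_eq_continuous_at)
    fix t
    have un: "u t \<noteq> 0" using upos[of t] by auto
    then show Fn: "?F t \<noteq> 0" by (auto simp: u_def)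
    have Feq: "?F t = circ r t * u t" using nz by (simp add: u_def)
    then have nF: "cmod (?F t) = r * cmod (u t)" using \<open>r > 0\<close> by (simp add: norm_mult)
    have "u t = exp (Ln (u t))" using un by simp
    also have "\<dots> = of_real (exp (Re (Ln (u t)))) * exp (\<i> * of_real (Im (Ln (u t))))"
      by (metis complex_eq exp_add exp_of_real)
    finally have "u t = of_real (cmod (u t)) * exp (\<i> * of_real (Im (Ln (u t))))"
      using un by (simp add: Re_Ln)
    then have "?F t = of_real r * exp (\<i> * of_real t) * (of_real (cmod (u t)) * exp (\<i> * of_real (Im (Ln (u t)))))"
      using Feq by simp
    then show "is_Arg (?F t) (\<phi> t)"
      unfolding is_Arg_def nF by (simp add: \<phi>_def exp_add algebra_simps)
  qed
  have per: "\<phi> (t + 2 * pi) = \<phi> t + 2 * pi" for t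
  proof -
    have "exp (\<i> * complex_of_real (t + 2 * pi)) = exp (\<i> * of_real t)"
      by (simp add: exp_add algebra_simps)
    then have "u (t + 2 * pi) = u t" unfolding u_def by simp
    then show ?thesis by (simp add: \<phi>_def)
  qed
  have "(\<phi> has_real_derivative Im (F' t / ?F t)) (at t)" for t
    using diff[of t] arg_branch_speed[OF br _ F[of t]] by blast
  with br per show ?thesis by (rule that)
qed

section \<open>Harmonic perturbations of the identity\<close>

abbreviation powser :: "(nat \<Rightarrow> complex) \<Rightarrow> complex \<Rightarrow> complex" where
  "powser c z \<equiv> \<Sum>n. c n * z ^ n"

definition perturbed_id :: "(nat \<Rightarrow> complex) \<Rightarrow> (nat \<Rightarrow> complex) \<Rightarrow> complex \<Rightarrow> complex" where
  "perturbed_id a b z = z + powser a z + cnj (powser b z)"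

text \<open>
  The coefficient of \<open>r ^ n\<close> in the majorant of \<open>A - \<alpha> f - (1 - \<alpha>) z\<close>, where \<open>f\<close> is the perturbed
  identity and \<open>\<i> A\<close> its derivative along circles about the origin.
\<close>
definition weight :: "real \<Rightarrow> (nat \<Rightarrow> complex) \<Rightarrow> (nat \<Rightarrow> complex) \<Rightarrow> nat \<Rightarrow> real" where
  "weight \<alpha> a b n = (real n - \<alpha>) * cmod (a n) + (real n + \<alpha>) * cmod (b n)"

lemma has_derivative_add_cnj:
  assumes "(H has_field_derivative H') (at z)" "(G has_field_derivative G') (at z)"
  shows "((\<lambda>z. H z + cnj (G z)) has_derivative (\<lambda>v. H' * v + cnj (G' * v))) (at z)"
  using assms
  by (intro has_derivative_add has_derivative_cnj) (auto simp: has_field_derivative_def)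

text \<open>
  Differentiating \<open>H + cnj G\<close> in the direction \<open>\<i>\<close> multiplies \<open>H'\<close> and \<open>G'\<close> by \<open>\<i>\<close>. Two such
  derivatives produce the factor \<open>-1\<close> that makes the Laplacian vanish.
\<close>

lemma harmonic_complex_on_add_cnj:
  assumes S: "open S"
    and H: "\<And>z. z \<in> S \<Longrightarrow> (H has_field_derivative H1 z) (at z)"
      "\<And>z. z \<in> S \<Longrightarrow> (H1 has_field_derivative H2 z) (at z)"
    and G: "\<And>z. z \<in> S \<Longrightarrow> (G has_field_derivative G1 z) (at z)"
      "\<And>z. z \<in> S \<Longrightarrow> (G1 has_field_derivative G2 z) (at z)"
    and cont: "continuous_on S H2" "continuous_on S G2"
  shows "harmonic_complex_on (\<lambda>z. H z + cnj (G z)) S"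
  unfolding harmonic_complex_on_def
proof (intro conjI exI ballI)
  fix z assume z: "z \<in> S"
  have lin: "(\<lambda>v. P * v + cnj (Q * v)) = (\<lambda>v. Re v *\<^sub>R (P + cnj Q) + Im v *\<^sub>R (\<i> * P + cnj (\<i> * Q)))"
    for P Q :: complex by (auto simp: complex_eq_iff algebra_simps)
  show "((\<lambda>z. H z + cnj (G z)) has_derivative
      (\<lambda>v. Re v *\<^sub>R (\<lambda>z. H1 z + cnj (G1 z)) z + Im v *\<^sub>R (\<lambda>z. \<i> * H1 z + cnj (\<i> * G1 z)) z)) (at z)"
    using has_derivative_add_cnj[OF H(1)[OF z] G(1)[OF z]] unfolding lin .
  show "((\<lambda>z. H1 z + cnj (G1 z)) has_derivative
      (\<lambda>v. Re v *\<^sub>R (\<lambda>z. H2 z + cnj (G2 z)) z + Im v *\<^sub>R (\<lambda>z. \<i> * H2 z + cnj (\<i> * G2 z)) z)) (at z)"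
    using has_derivative_add_cnj[OF H(2)[OF z] G(2)[OF z]] unfolding lin .
  show "((\<lambda>z. \<i> * H1 z + cnj (\<i> * G1 z)) has_derivative
      (\<lambda>v. Re v *\<^sub>R (\<lambda>z. \<i> * H2 z + cnj (\<i> * G2 z)) z + Im v *\<^sub>R (\<lambda>z. \<i> * (\<i> * H2 z) + cnj (\<i> * (\<i> * G2 z))) z)) (at z)"
    using has_derivative_add_cnj[OF DERIV_cmult[OF H(2)[OF z]] DERIV_cmult[OF G(2)[OF z]], of "\<i>" "\<i>"]
    unfolding lin .
  show "(\<lambda>z. H2 z + cnj (G2 z)) z + (\<lambda>z. \<i> * (\<i> * H2 z) + cnj (\<i> * (\<i> * G2 z))) z = 0"
    by (simp add: mult.assoc[symmetric])
qed (use S cont in \<open>auto intro!: continuous_intros\<close>)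

text \<open>
  Convergence of the weighted series is separated from its size: the extremal map of the
  sharpness proof is evaluated on a circle where the series converges but the size condition
  just fails.
\<close>
locale weighted_coeffs =
  fixes \<alpha> \<rho> :: real and a b :: "nat \<Rightarrow> complex"
  assumes alpha: "0 \<le> \<alpha>" "\<alpha> < 1"
    and zero: "a 0 = 0" "b 0 = 0"
    and summable_weight: "\<And>r. 0 < r \<Longrightarrow> r < \<rho> \<Longrightarrow> summable (\<lambda>n. weight \<alpha> a b n * r ^ n)"
begin

text \<open>
  Because \<open>\<alpha> \<le> n \<alpha>\<close> for \<open>n \<ge> 1\<close>, the weights dominate, up to the factor \<open>1 - \<alpha>\<close>, the coefficients of
  the derivatives of both series.
\<close>

lemma weight_lower: "(1 - \<alpha>) * (real n * (cmod (a n) + cmod (b n))) \<le> weight \<alpha> a b n"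
proof (cases n)
  case 0
  then show ?thesis by (simp add: weight_def zero)
next
  case (Suc m)
  have "(1 - \<alpha>) * real n \<le> real n - \<alpha>" "(1 - \<alpha>) * real n \<le> real n + \<alpha>"
    using alpha Suc mult_left_mono[of 1 "real n" \<alpha>] by (simp_all add: algebra_simps)
  then have "(1 - \<alpha>) * real n * cmod (a n) + (1 - \<alpha>) * real n * cmod (b n) \<le> weight \<alpha> a b n"
    unfolding weight_def by (intro add_mono mult_right_mono) auto
  then show ?thesis by (simp add: algebra_simps)
qed

lemma summable_dominated:
  assumes r: "0 < r" "r < \<rho>" and le: "\<And>n. \<bar>c n\<bar> \<le> K * (real n * (cmod (a n) + cmod (b n)))" and K: "K \<ge> 0"
  shows "summable (\<lambda>n. c n * r ^ n)"
proof (rule summable_comparison_test')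
  show "summable (\<lambda>n. K / (1 - \<alpha>) * (weight \<alpha> a b n * r ^ n))"
    by (intro summable_mult summable_weight r)
  fix n :: nat
  have "\<bar>c n\<bar> \<le> K / (1 - \<alpha>) * ((1 - \<alpha>) * (real n * (cmod (a n) + cmod (b n))))"
    using le[of n] alpha by simp
  also have "\<dots> \<le> K / (1 - \<alpha>) * weight \<alpha> a b n"
    using K alpha by (intro mult_left_mono weight_lower) auto
  finally have "\<bar>c n\<bar> * r ^ n \<le> K / (1 - \<alpha>) * weight \<alpha> a b n * r ^ n"
    using r by (intro mult_right_mono) auto
  then show "norm (c n * r ^ n) \<le> K / (1 - \<alpha>) * (weight \<alpha> a b n * r ^ n)"
    using r by (simp add: abs_mult)
qed

lemma cmod_le_n_mult: "cmod (a n) \<le> real n * (cmod (a n) + cmod (b n))"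
  "cmod (b n) \<le> real n * (cmod (a n) + cmod (b n))"
proof -
  have "cmod (a n) + cmod (b n) \<le> real n * (cmod (a n) + cmod (b n))"
  proof (cases n)
    case 0 then show ?thesis by (simp add: zero)
  next
    case (Suc m)
    then show ?thesis using mult_right_mono[of 1 "real n" "cmod (a n) + cmod (b n)"] by simp
  qed
  then show "cmod (a n) \<le> real n * (cmod (a n) + cmod (b n))"
    "cmod (b n) \<le> real n * (cmod (a n) + cmod (b n))"
    using norm_ge_zero[of "a n"] norm_ge_zero[of "b n"] by linarith+
qed

lemma summable_powser:
  assumes "norm z < \<rho>"
  shows "summable (\<lambda>n. a n * z ^ n)" "summable (\<lambda>n. b n * z ^ n)"
proof -
  obtain r where r: "norm z < r" "r < \<rho>" using assms dense by blast
  then have r0: "0 < r" using norm_ge_zero[of z] by linarith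
  have "summable (\<lambda>n. cmod (a n) * r ^ n)" "summable (\<lambda>n. cmod (b n) * r ^ n)"
    by (rule summable_dominated[OF r0 r(2), where K = 1]; simp only: mult_1 abs_norm_cancel cmod_le_n_mult zero_le_one)+
  then have "summable (\<lambda>n. norm (a n * of_real r ^ n))" "summable (\<lambda>n. norm (b n * of_real r ^ n))"
    using r0 by (simp_all add: norm_mult norm_power)
  then have "summable (\<lambda>n. a n * of_real r ^ n)" "summable (\<lambda>n. b n * of_real r ^ n)"
    by (blast intro: summable_norm_cancel)+
  then show "summable (\<lambda>n. a n * z ^ n)" "summable (\<lambda>n. b n * z ^ n)"
    using r r0 by (auto intro: powser_inside)
qed

lemma has_field_derivative_powser:
  assumes "norm z < \<rho>"
  shows "(powser a has_field_derivative powser (diffs a) z) (at z)"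
    "(powser b has_field_derivative powser (diffs b) z) (at z)"
  using termdiffs_strong' assms summable_powser by blast+

lemma harmonic_perturbed_id: "harmonic_complex_on (perturbed_id a b) (ball 0 \<rho>)"
proof -
  have sm: "summable (\<lambda>n. diffs c n * z ^ n)"
    if "\<And>z. cmod z < \<rho> \<Longrightarrow> summable (\<lambda>n. c n * z ^ n)" "cmod z < \<rho>" for c z
    using that by (rule termdiff_converges[rotated])
  have a: "\<And>z. cmod z < \<rho> \<Longrightarrow> summable (\<lambda>n. a n * z ^ n)"
    "\<And>z. cmod z < \<rho> \<Longrightarrow> summable (\<lambda>n. b n * z ^ n)"
    using summable_powser by auto
  note a1 = sm[OF a(1)] sm[OF a(2)]
  note a2 = sm[OF a1(1)] sm[OF a1(2)]
  have "harmonic_complex_on (\<lambda>z. (z + powser a z) + cnj (powser b z)) (ball 0 \<rho>)"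
  proof (rule harmonic_complex_on_add_cnj)
    fix z :: complex assume "z \<in> ball 0 \<rho>"
    then have z: "cmod z < \<rho>" by simp
    show "((\<lambda>z. z + powser a z) has_field_derivative 1 + powser (diffs a) z) (at z)"
      using termdiffs_strong'[OF a(1) z] by (intro DERIV_add DERIV_ident)
    show "((\<lambda>z. 1 + powser (diffs a) z) has_field_derivative 0 + powser (diffs (diffs a)) z) (at z)"
      using termdiffs_strong'[OF a1(1) z] by (intro DERIV_add DERIV_const)
    show "(powser b has_field_derivative powser (diffs b) z) (at z)"
      using termdiffs_strong'[OF a(2) z] .
    show "(powser (diffs b) has_field_derivative powser (diffs (diffs b)) z) (at z)"
      using termdiffs_strong'[OF a1(2) z] .
  next
    show "continuous_on (ball 0 \<rho>) (\<lambda>z. 0 + powser (diffs (diffs a)) z)"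
      "continuous_on (ball 0 \<rho>) (powser (diffs (diffs b)))"
      using termdiffs_strong'[OF a2(1)] termdiffs_strong'[OF a2(2)]
      by (auto intro!: continuous_at_imp_continuous_on DERIV_isCont)
  qed auto
  then show ?thesis by (simp add: perturbed_id_def[abs_def])
qed

end

locale small_coeffs = weighted_coeffs +
  assumes weight_less: "\<And>r. 0 < r \<Longrightarrow> r < \<rho> \<Longrightarrow> (\<Sum>n. weight \<alpha> a b n * r ^ n) < (1 - \<alpha>) * r"
begin

text \<open>
  The derivatives of the two power series are bounded on the closed disk by the values at \<open>r\<close> of their
  majorants, whose sum is less than \<open>1\<close> by the lower bound for the weights.
\<close>

lemma lipschitz:
  assumes "r < \<rho>"
  obtains L where "L < 1" "\<And>z w. z \<in> cball 0 r \<Longrightarrow> w \<in> cball 0 r \<Longrightarrow>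
    norm ((perturbed_id a b z - z) - (perturbed_id a b w - w)) \<le> L * norm (z - w)"
proof (cases "r > 0")
  case r: True
  define A where "A = (\<Sum>n. cmod (diffs a n) * r ^ n)"
  define B where "B = (\<Sum>n. cmod (diffs b n) * r ^ n)"
  have abs_series: "summable (\<lambda>n. cmod (diffs c n) * r ^ n)"
    "(\<lambda>n. (real n * cmod (c n)) * r ^ n) sums (r * (\<Sum>n. cmod (diffs c n) * r ^ n))"
    if c: "summable (\<lambda>n. (real n * cmod (c n)) * r ^ n)" for c
  proof -
    have eq: "(real (Suc n) * cmod (c (Suc n))) * r ^ Suc n = r * (cmod (diffs c n) * r ^ n)" for n
      by (simp add: diffs_def norm_mult del: of_nat_Suc)
    have "summable (\<lambda>n. (real (Suc n) * cmod (c (Suc n))) * r ^ Suc n)"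
      using c by (subst summable_Suc_iff)
    then have "summable (\<lambda>n. r * (cmod (diffs c n) * r ^ n))"
      unfolding eq .
    then show s: "summable (\<lambda>n. cmod (diffs c n) * r ^ n)"
      using r by (subst (asm) summable_cmult_iff) auto
    have "(\<lambda>n. (real (Suc n) * cmod (c (Suc n))) * r ^ Suc n) sums (r * (\<Sum>n. cmod (diffs c n) * r ^ n))"
      unfolding eq by (intro sums_mult summable_sums s)
    then show "(\<lambda>n. (real n * cmod (c n)) * r ^ n) sums (r * (\<Sum>n. cmod (diffs c n) * r ^ n))"
      by (subst (asm) sums_Suc_iff) simp
  qed
  have sa: "summable (\<lambda>n. (real n * cmod (a n)) * r ^ n)"
    by (rule summable_dominated[OF r assms, where K = 1]) (auto simp: algebra_simps)
  have sb: "summable (\<lambda>n. (real n * cmod (b n)) * r ^ n)"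
    by (rule summable_dominated[OF r assms, where K = 1]) (auto simp: algebra_simps)
  have "(1 - \<alpha>) * (r * A + r * B) \<le> (\<Sum>n. weight \<alpha> a b n * r ^ n)"
  proof (rule sums_le[OF _ _ summable_sums[OF summable_weight[OF r assms]]])
    show "(\<lambda>n. (1 - \<alpha>) * ((real n * cmod (a n)) * r ^ n + (real n * cmod (b n)) * r ^ n))
        sums ((1 - \<alpha>) * (r * A + r * B))"
      unfolding A_def B_def by (intro sums_mult sums_add abs_series sa sb)
    show "(1 - \<alpha>) * ((real n * cmod (a n)) * r ^ n + (real n * cmod (b n)) * r ^ n)
        \<le> weight \<alpha> a b n * r ^ n" for n
      using mult_right_mono[OF weight_lower[of n], of "r ^ n"] r by (simp add: algebra_simps)
  qed
  also have "\<dots> < (1 - \<alpha>) * r" by (rule weight_less[OF r assms])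
  finally have "(1 - \<alpha>) * (r * (A + B)) < (1 - \<alpha>) * (r * 1)" by (simp add: distrib_left)
  then have AB: "A + B < 1" using r alpha by (simp only: mult_less_cancel_left_pos diff_gt_0_iff_gt)
  have bound: "norm (powser c z - powser c w) \<le> (\<Sum>n. cmod (diffs c n) * r ^ n) * norm (z - w)"
    if c: "summable (\<lambda>n. cmod (diffs c n) * r ^ n)"
      and d: "\<And>z. cmod z < \<rho> \<Longrightarrow> (powser c has_field_derivative powser (diffs c) z) (at z)"
      and z: "z \<in> cball 0 r" and w: "w \<in> cball 0 r" for c z w
  proof (rule field_differentiable_bound[OF convex_cball _ _ z w])
    fix x :: complex assume x: "x \<in> cball 0 r"
    show "(powser c has_field_derivative powser (diffs c) x) (at x within cball 0 r)"
      using d[of x] x assms by (auto intro: has_field_derivative_at_within)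
    have le: "norm (diffs c n * x ^ n) \<le> cmod (diffs c n) * r ^ n" for n
      using x by (auto simp: norm_mult norm_power intro!: mult_left_mono power_mono)
    show "norm (powser (diffs c) x) \<le> (\<Sum>n. cmod (diffs c n) * r ^ n)"
      using norm_suminf_le[OF le c] .
  qed
  show ?thesis
  proof (rule that[OF AB])
    fix z w :: complex assume zw: "z \<in> cball 0 r" "w \<in> cball 0 r"
    have "(perturbed_id a b z - z) - (perturbed_id a b w - w)
        = (powser a z - powser a w) + cnj (powser b z - powser b w)"
      by (simp add: perturbed_id_def)
    then have "norm ((perturbed_id a b z - z) - (perturbed_id a b w - w))
        \<le> norm (powser a z - powser a w) + norm (powser b z - powser b w)"
      by (metis norm_triangle_ineq complex_mod_cnj)
    also have "\<dots> \<le> A * norm (z - w) + B * norm (z - w)"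
      unfolding A_def B_def
      by (intro add_mono bound abs_series sa sb has_field_derivative_powser zw)
    finally show "norm ((perturbed_id a b z - z) - (perturbed_id a b w - w)) \<le> (A + B) * norm (z - w)"
      by (simp add: algebra_simps)
  qed
next
  case False
  show ?thesis
  proof (rule that[of 0])
    fix z w :: complex assume "z \<in> cball 0 r" "w \<in> cball 0 r"
    then have "norm z \<le> r" "norm w \<le> r" by auto
    then have "z = 0" "w = 0" using False norm_ge_zero[of z] norm_ge_zero[of w]
      by (metis norm_le_zero_iff order_trans linorder_not_less)+
    then show "norm ((perturbed_id a b z - z) - (perturbed_id a b w - w)) \<le> 0 * norm (z - w)" by simp
  qed simp
qed

lemma inj_on_perturbed_id: "inj_on (perturbed_id a b) (ball 0 \<rho>)"
proof (rule inj_onI)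
  fix z w assume zw: "z \<in> ball 0 \<rho>" "w \<in> ball 0 \<rho>" "perturbed_id a b z = perturbed_id a b w"
  define r where "r = max (norm z) (norm w)"
  have "r < \<rho>" using zw by (auto simp: r_def)
  then obtain L where "L < 1" and L: "norm ((perturbed_id a b z - z) - (perturbed_id a b w - w)) \<le> L * norm (z - w)"
    using lipschitz[of r] by (metis mem_cball_0 r_def max.cobounded1 max.cobounded2)
  then have "1 * norm (z - w) \<le> L * norm (z - w)" using zw by (simp add: norm_minus_commute)
  then have "norm (z - w) \<le> 0" using \<open>L < 1\<close>
    by (metis mult_le_cancel_right norm_ge_zero order_le_less linorder_not_less)
  then show "z = w" by simp
qed

lemma perturbed_id_0: "perturbed_id a b 0 = 0"
  by (simp add: perturbed_id_def zero)

text \<open>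
  The Lipschitz bound against the fixed point \<open>0\<close> says \<open>|f z / z - 1| < 1\<close>.
\<close>

lemma Re_quotient_pos:
  assumes "z \<noteq> 0" "norm z < \<rho>"
  shows "Re (perturbed_id a b z / z) > 0"
proof -
  obtain L where "L < 1" and L: "norm ((perturbed_id a b z - z) - (perturbed_id a b 0 - 0)) \<le> L * norm (z - 0)"
    using lipschitz[OF assms(2)] by (metis mem_cball_0 norm_zero norm_ge_zero order_refl)
  then have "norm (perturbed_id a b z - z) < norm z"
    using assms(1) by (simp add: perturbed_id_0) (smt (verit) mult_less_cancel_right2 zero_less_norm_iff)
  then have "norm ((perturbed_id a b z - z) / z) < 1"
    using assms(1) by (simp add: norm_divide)
  moreover have "perturbed_id a b z / z = 1 + (perturbed_id a b z - z) / z"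
    using assms(1) by (simp add: field_simps)
  ultimately show ?thesis using abs_Re_le_cmod[of "(perturbed_id a b z - z) / z"] by simp
qed

end

section \<open>Angular speed\<close>

text \<open>
  This is \<open>z h' - cnj (z g')\<close> for \<open>h = z + powser a z\<close> and \<open>g = powser b z\<close>; the curve
  \<open>t \<mapsto> f (circ r t)\<close> has velocity \<open>\<i>\<close> times it.
\<close>
definition angular_part :: "(nat \<Rightarrow> complex) \<Rightarrow> (nat \<Rightarrow> complex) \<Rightarrow> complex \<Rightarrow> complex" where
  "angular_part a b z = z + powser (\<lambda>n. of_nat n * a n) z - cnj (powser (\<lambda>n. of_nat n * b n) z)"

lemma mult_powser_diffs_sums:
  fixes z :: complex
  assumes z: "norm z < \<rho>" and c: "\<And>z. cmod z < \<rho> \<Longrightarrow> summable (\<lambda>n. c n * z ^ n)"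
  shows "(\<lambda>n. of_nat n * c n * z ^ n) sums (z * powser (diffs c) z)"
proof -
  have "(\<lambda>n. of_nat n * c n * z ^ (n - Suc 0)) sums powser (diffs c) z"
    using diffs_equiv termdiff_converges[OF z c] by blast
  from sums_mult[OF this, of z]
  have "(\<lambda>n. z * (of_nat n * c n * z ^ (n - Suc 0))) sums (z * powser (diffs c) z)" .
  moreover have "z * (of_nat n * c n * z ^ (n - Suc 0)) = of_nat n * c n * z ^ n" for n
    by (cases n) auto
  ultimately show ?thesis by simp
qed

lemma circle_velocity:
  assumes sm: "\<And>z. cmod z < \<rho> \<Longrightarrow> summable (\<lambda>n. a n * z ^ n)"
      "\<And>z. cmod z < \<rho> \<Longrightarrow> summable (\<lambda>n. b n * z ^ n)"
    and r: "0 \<le> r" "r < \<rho>"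
  shows "((\<lambda>t. perturbed_id a b (circ r t)) has_vector_derivative \<i> * angular_part a b (circ r \<theta>)) (at \<theta>)"
proof -
  let ?z = "circ r \<theta>"
  have z: "cmod ?z < \<rho>" using r by (simp add: norm_mult)
  have c: "(circ r has_derivative (\<lambda>x. x *\<^sub>R (\<i> * ?z))) (at \<theta>)"
    unfolding has_vector_derivative_def[symmetric]
    by (rule has_vector_derivative_real_field derivative_eq_intros refl | simp)+
  have "((\<lambda>z. z + powser a z) has_field_derivative 1 + powser (diffs a) ?z) (at ?z)"
    using termdiffs_strong'[OF sm(1) z] by (intro DERIV_add DERIV_ident)
  from has_derivative_compose[OF c has_derivative_add_cnj[OF this termdiffs_strong'[OF sm(2) z]]]
  have "((\<lambda>t. perturbed_id a b (circ r t)) has_derivative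
      (\<lambda>x. (1 + powser (diffs a) ?z) * (x *\<^sub>R (\<i> * ?z)) + cnj (powser (diffs b) ?z * (x *\<^sub>R (\<i> * ?z))))) (at \<theta>)"
    by (simp only: perturbed_id_def)
  moreover have "(\<lambda>x. (1 + powser (diffs a) ?z) * (x *\<^sub>R (\<i> * ?z)) + cnj (powser (diffs b) ?z * (x *\<^sub>R (\<i> * ?z))))
      = (\<lambda>x. x *\<^sub>R (\<i> * (?z + ?z * powser (diffs a) ?z - cnj (?z * powser (diffs b) ?z))))"
    by (rule ext) (simp add: scaleR_conv_of_real algebra_simps)
  moreover have "?z * powser (diffs a) ?z = powser (\<lambda>n. of_nat n * a n) ?z"
    "?z * powser (diffs b) ?z = powser (\<lambda>n. of_nat n * b n) ?z"
    using mult_powser_diffs_sums[OF z sm(1)] mult_powser_diffs_sums[OF z sm(2)] by (auto simp: sums_iff)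
  ultimately show ?thesis by (simp only: has_vector_derivative_def angular_part_def)
qed

text \<open>
  With \<open>\<zeta> = P / Q\<close> the hypothesis says that \<open>\<zeta>\<close> is closer to \<open>1\<close> than to \<open>2 \<alpha> - 1\<close>; the perpendicular
  bisector of these two points is the line \<open>Re \<zeta> = \<alpha>\<close>. Testing norms of linear combinations of \<open>P\<close> and
  \<open>Q\<close> avoids estimating a quotient of two series.
\<close>

lemma Re_divide_gt_if_norm_less:
  fixes P Q :: complex
  assumes "norm (P - Q) < norm (P + of_real (1 - 2 * \<alpha>) * Q)" "\<alpha> < 1" "Q \<noteq> 0"
  shows "Re (P / Q) > \<alpha>"
proof -
  have "P - Q = (P / Q - 1) * Q" "P + of_real (1 - 2 * \<alpha>) * Q = (P / Q + of_real (1 - 2 * \<alpha>)) * Q"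
    using assms(3) by (simp_all add: field_simps)
  then have "norm (P / Q - 1) * norm Q < norm (P / Q + of_real (1 - 2 * \<alpha>)) * norm Q"
    using assms(1) by (metis norm_mult)
  then have "norm (P / Q - 1) < norm (P / Q + of_real (1 - 2 * \<alpha>))"
    using assms(3) by (simp add: mult_less_cancel_right)
  then have "(norm (P / Q - 1))\<^sup>2 < (norm (P / Q + of_real (1 - 2 * \<alpha>)))\<^sup>2"
    by (intro power_strict_mono) auto
  then have "0 < 4 * (1 - \<alpha>) * (Re (P / Q) - \<alpha>)"
    unfolding cmod_power2 by (simp add: power2_eq_square algebra_simps)
  then show ?thesis using assms(2) by (simp add: zero_less_mult_iff)
qed

context small_coeffs begin

text \<open>
  Write \<open>A\<close> for the angular part. The coefficient moduli of \<open>A - f\<close> and of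
  \<open>A + (1 - 2 \<alpha>) f - 2 (1 - \<alpha>) z\<close> add up to exactly twice the weights, so the
  triangle inequality leaves a surplus of the leading term \<open>2 (1 - \<alpha>) z\<close> over both remainders.
\<close>

lemma angular_speed_gt:
  assumes "z \<noteq> 0" "norm z < \<rho>"
  shows "Re (angular_part a b z / perturbed_id a b z) > \<alpha>"
proof (rule Re_divide_gt_if_norm_less)
  show "\<alpha> < 1" by (rule alpha)
  show "perturbed_id a b z \<noteq> 0" using Re_quotient_pos[OF assms] by auto
  define r where "r = norm z"
  have r: "0 < r" "r < \<rho>" using assms by (auto simp: r_def)
  note sa = summable_powser(1)[OF assms(2)] and sb = summable_powser(2)[OF assms(2)]
  have na: "(\<lambda>n. of_nat n * a n * z ^ n) sums powser (\<lambda>n. of_nat n * a n) z"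
    using mult_powser_diffs_sums[OF assms(2) summable_powser(1)] by (simp add: sums_iff)
  have nb: "(\<lambda>n. of_nat n * b n * z ^ n) sums powser (\<lambda>n. of_nat n * b n) z"
    using mult_powser_diffs_sums[OF assms(2) summable_powser(2)] by (simp add: sums_iff)
  let ?k = "1 - 2 * \<alpha>"
  have bd: "norm (X + cnj Y) \<le> (\<Sum>n. (cmod (c n) + cmod (d n)) * r ^ n)"
    if X: "(\<lambda>n. c n * z ^ n) sums X" and Y: "(\<lambda>n. d n * z ^ n) sums Y"
      and s: "summable (\<lambda>n. (cmod (c n) + cmod (d n)) * r ^ n)" for c d X Y
  proof -
    have sm: "(\<lambda>n. c n * z ^ n + cnj (d n * z ^ n)) sums (X + cnj Y)"
      using X Y by (intro sums_add) (simp_all only: sums_cnj)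
    have "norm (c n * z ^ n + cnj (d n * z ^ n)) \<le> (cmod (c n) + cmod (d n)) * r ^ n" for n
      using norm_triangle_ineq[of "c n * z ^ n" "cnj (d n * z ^ n)"]
      by (simp add: norm_mult norm_power r_def algebra_simps)
    from norm_suminf_le[OF this s] show ?thesis unfolding sums_unique[OF sm] .
  qed
  have lin: "(\<lambda>n. ((s * of_nat n + t) * c n) * z ^ n) sums (s * powser (\<lambda>n. of_nat n * c n) z + t * powser c z)"
    if c: "summable (\<lambda>n. c n * z ^ n)" and nc: "(\<lambda>n. of_nat n * c n * z ^ n) sums powser (\<lambda>n. of_nat n * c n) z"
    for c s t
    using sums_add[OF sums_mult[OF nc, of s] sums_mult[OF summable_sums[OF c], of t]]
    by (simp only: distrib_right mult.assoc)
  define \<kappa> where "\<kappa> = complex_of_real ?k"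
  define c1 where "c1 n = (1 * of_nat n + - 1) * a n" for n
  define d1 where "d1 n = (- 1 * of_nat n + - 1) * b n" for n
  define c2 where "c2 n = (1 * of_nat n + \<kappa>) * a n" for n
  define d2 where "d2 n = (- 1 * of_nat n + \<kappa>) * b n" for n
  note c1 = lin[OF sa na, of 1 "- 1", folded c1_def]
    and d1 = lin[OF sb nb, of "- 1" "- 1", folded d1_def]
    and c2 = lin[OF sa na, of 1 \<kappa>, folded c2_def]
    and d2 = lin[OF sb nb, of "- 1" \<kappa>, folded d2_def]
  \<comment> \<open>At \<open>n = 0\<close> the factors on the right may be negative, but there both coefficients vanish.\<close>
  have norms: "cmod (c1 n) = (real n - 1) * cmod (a n)" "cmod (d1 n) = (real n + 1) * cmod (b n)"
    "cmod (c2 n) = (real n + ?k) * cmod (a n)" "cmod (d2 n) = (real n - ?k) * cmod (b n)" for n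
  proof -
    have of_real: "c1 n = of_real (real n - 1) * a n" "d1 n = - (of_real (real n + 1) * b n)"
      "c2 n = of_real (real n + ?k) * a n" "d2 n = - (of_real (real n - ?k) * b n)"
      by (simp_all add: c1_def d1_def c2_def d2_def \<kappa>_def algebra_simps)
    have "\<bar>real n - 1\<bar> * cmod (a n) = (real n - 1) * cmod (a n)"
      "\<bar>real n + ?k\<bar> * cmod (a n) = (real n + ?k) * cmod (a n)"
      "\<bar>real n - ?k\<bar> * cmod (b n) = (real n - ?k) * cmod (b n)"
      "\<bar>real n + 1\<bar> = real n + 1"
      using alpha by (cases n; simp add: zero)+
    then show "cmod (c1 n) = (real n - 1) * cmod (a n)" "cmod (d1 n) = (real n + 1) * cmod (b n)"
      "cmod (c2 n) = (real n + ?k) * cmod (a n)" "cmod (d2 n) = (real n - ?k) * cmod (b n)"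
      unfolding of_real norm_minus_cancel norm_mult norm_of_real by simp_all
  qed
  have sum2: "cmod (c1 n) + cmod (d1 n) + (cmod (c2 n) + cmod (d2 n)) = 2 * weight \<alpha> a b n" for n
    unfolding norms by (simp add: weight_def algebra_simps)
  have dom: "summable (\<lambda>n. x n * r ^ n)" if "\<And>n. 0 \<le> x n" "\<And>n. x n \<le> 2 * weight \<alpha> a b n" for x :: "nat \<Rightarrow> real"
  proof (rule summable_comparison_test'[OF summable_mult[OF summable_weight[OF r], of 2]])
    fix n
    have "x n * r ^ n \<le> 2 * weight \<alpha> a b n * r ^ n" using that r by (intro mult_right_mono) auto
    then show "norm (x n * r ^ n) \<le> 2 * (weight \<alpha> a b n * r ^ n)" using that r by (simp add: abs_mult)
  qed
  have s1: "summable (\<lambda>n. (cmod (c1 n) + cmod (d1 n)) * r ^ n)"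
    and s2: "summable (\<lambda>n. (cmod (c2 n) + cmod (d2 n)) * r ^ n)"
    by (rule dom; use sum2 in \<open>simp flip: sum2\<close>)+
  have tot: "(\<Sum>n. (cmod (c1 n) + cmod (d1 n)) * r ^ n) + (\<Sum>n. (cmod (c2 n) + cmod (d2 n)) * r ^ n)
      < 2 * (1 - \<alpha>) * r"
  proof -
    have "(\<Sum>n. (cmod (c1 n) + cmod (d1 n)) * r ^ n) + (\<Sum>n. (cmod (c2 n) + cmod (d2 n)) * r ^ n)
        = (\<Sum>n. (cmod (c1 n) + cmod (d1 n)) * r ^ n + (cmod (c2 n) + cmod (d2 n)) * r ^ n)"
      by (rule suminf_add[OF s1 s2])
    also have "\<dots> = (\<Sum>n. 2 * (weight \<alpha> a b n * r ^ n))"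
      by (simp only: sum2 flip: distrib_right mult.assoc)
    also have "\<dots> = 2 * (\<Sum>n. weight \<alpha> a b n * r ^ n)" by (rule suminf_mult[OF summable_weight[OF r]])
    finally show ?thesis using weight_less[OF r] by (simp add: left_diff_distrib)
  qed
  let ?P = "angular_part a b z" and ?Q = "perturbed_id a b z"
  have alg: "z + X - cnj Y - (z + U + cnj V) = (1 * X + - 1 * U) + cnj (- 1 * Y + - 1 * V)" for X Y U V
    by simp
  have alg': "z + X - cnj Y + of_real ?k * (z + U + cnj V) - of_real (2 * (1 - \<alpha>)) * z
      = (1 * X + \<kappa> * U) + cnj (- 1 * Y + \<kappa> * V)" for X Y U V
    by (simp add: \<kappa>_def algebra_simps)
  have PQ: "?P - ?Q = (1 * powser (\<lambda>n. of_nat n * a n) z + - 1 * powser a z)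
      + cnj (- 1 * powser (\<lambda>n. of_nat n * b n) z + - 1 * powser b z)"
    unfolding angular_part_def perturbed_id_def by (rule alg)
  have PQ': "?P + of_real ?k * ?Q - of_real (2 * (1 - \<alpha>)) * z
     = (1 * powser (\<lambda>n. of_nat n * a n) z + \<kappa> * powser a z)
      + cnj (- 1 * powser (\<lambda>n. of_nat n * b n) z + \<kappa> * powser b z)"
    unfolding angular_part_def perturbed_id_def by (rule alg')
  have "norm (?P - ?Q) \<le> (\<Sum>n. (cmod (c1 n) + cmod (d1 n)) * r ^ n)"
    unfolding PQ by (rule bd[OF c1 d1 s1])
  moreover have "norm (?P + of_real ?k * ?Q - of_real (2 * (1 - \<alpha>)) * z) \<le> (\<Sum>n. (cmod (c2 n) + cmod (d2 n)) * r ^ n)"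
    unfolding PQ' by (rule bd[OF c2 d2 s2])
  moreover have "norm (of_real (2 * (1 - \<alpha>)) * z) = 2 * (1 - \<alpha>) * r"
    using alpha by (simp add: norm_mult r_def del: of_real_mult of_real_diff)
  moreover have "norm (of_real (2 * (1 - \<alpha>)) * z) \<le> norm (?P + of_real ?k * ?Q)
      + norm (?P + of_real ?k * ?Q - of_real (2 * (1 - \<alpha>)) * z)"
    using norm_triangle_ineq4[of "?P + of_real ?k * ?Q" "?P + of_real ?k * ?Q - of_real (2 * (1 - \<alpha>)) * z"]
    by (simp only: diff_diff_eq2 add_diff_cancel_left')
  ultimately show "norm (?P - ?Q) < norm (?P + of_real ?k * ?Q)" using tot by linarith
qed

theorem fully_starlike_perturbed_id: "fully_starlike_of_order \<alpha> (perturbed_id a b) \<rho>"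
  unfolding fully_starlike_of_order_def
proof (intro conjI allI impI)
  show "harmonic_complex_on (perturbed_id a b) (ball 0 \<rho>)" by (rule harmonic_perturbed_id)
  show "perturbed_id a b 0 = 0" by (rule perturbed_id_0)
  fix r assume "0 < r \<and> r < \<rho>"
  then have r: "0 < r" "r < \<rho>" by auto
  let ?f = "perturbed_id a b"
  have sub: "cball 0 r \<subseteq> ball (0::complex) \<rho>" "sphere 0 r \<subseteq> ball (0::complex) \<rho>" using r by auto
  show "inj_on ?f (sphere 0 r)" using inj_on_subset[OF inj_on_perturbed_id sub(2)] .
  have vel: "((\<lambda>t. ?f (circ r t)) has_vector_derivative \<i> * angular_part a b (circ r \<theta>)) (at \<theta>)" for \<theta>
    using circle_velocity[OF summable_powser] r by simp
  have pos: "Re (?f z / z) > 0" if "z \<in> sphere 0 r" for z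
    using that r by (intro Re_quotient_pos) auto
  obtain \<phi> where \<phi>: "arg_branch_on_circle ?f r \<phi>" "\<And>\<theta>. \<phi> (\<theta> + 2 * pi) = \<phi> \<theta> + 2 * pi"
    and d: "\<And>\<theta>. (\<phi> has_real_derivative Im (\<i> * angular_part a b (circ r \<theta>) / ?f (circ r \<theta>))) (at \<theta>)"
    using arg_branch_exists[OF r(1) pos vel] by blast
  have gt: "Im (\<i> * angular_part a b (circ r \<theta>) / ?f (circ r \<theta>)) > \<alpha>" for \<theta>
    using angular_speed_gt[of "circ r \<theta>"] r by (simp add: norm_mult flip: times_divide_eq_right)
  have mono: "strict_mono \<phi>"
  proof (rule strict_monoI)
    fix x y :: real assume "x < y"
    then show "\<phi> x < \<phi> y"
      by (rule DERIV_pos_imp_increasing) (use d gt alpha in \<open>blast intro: order_le_less_trans\<close>)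
  qed
  have cont: "continuous_on (cball 0 r) ?f"
  proof -
    have "isCont (powser a) z \<and> isCont (powser b) z" if "z \<in> cball 0 r" for z
      using that r has_field_derivative_powser[of z] by (auto dest: DERIV_isCont)
    then have "continuous_on (cball 0 r) (powser a)" "continuous_on (cball 0 r) (powser b)"
      by (auto intro!: continuous_at_imp_continuous_on)
    then show ?thesis unfolding perturbed_id_def[abs_def] by (intro continuous_intros)
  qed
  note D = starlike_domain_image_ball[OF r(1) cont inj_on_subset[OF inj_on_perturbed_id sub(1)] perturbed_id_0
      ray_meets_circle_image_once[OF r(1) \<phi>(1,2) mono]]
  have "bounded (?f ` ball 0 r)" "frontier (?f ` ball 0 r) = ?f ` sphere 0 r"
      "starlike_domain_0 (?f ` ball 0 r)"
    by (rule D; assumption)+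
  then show "\<exists>D. bounded D \<and> starlike_domain_0 D \<and> frontier D = ?f ` sphere 0 r"
    by blast
  show "\<exists>\<phi>. arg_branch_on_circle ?f r \<phi> \<and> (\<forall>\<theta>\<in>{0..2 * pi}. \<exists>d > \<alpha>. (\<phi> has_real_derivative d) (at \<theta>))"
    using \<phi>(1) d gt by blast
qed

end

section \<open>The majorant series and the radius\<close>

text \<open>
  Multiplication by the geometric series \<open>1 / (1 - x)\<close> replaces coefficients by their partial sums.
\<close>

lemma sums_partial_sums_powser:
  fixes x :: real
  assumes x: "0 \<le> x" "x < 1" and f: "\<And>n. f n \<ge> 0" and s: "(\<lambda>n. f n * x ^ n) sums s"
  shows "(\<lambda>n. (\<Sum>i\<le>n. f i) * x ^ n) sums (s / (1 - x))"
proof -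
  have "(\<lambda>n. \<Sum>i\<le>n. (f i * x ^ i) * x ^ (n - i)) sums ((\<Sum>n. f n * x ^ n) * (\<Sum>n. x ^ n))"
    using x f sums_summable[OF s] by (intro Cauchy_product_sums) (auto simp: abs_mult intro!: summable_geometric)
  moreover have "(\<Sum>i\<le>n. (f i * x ^ i) * x ^ (n - i)) = (\<Sum>i\<le>n. f i) * x ^ n" for n
    unfolding sum_distrib_right by (intro sum.cong) (auto simp flip: power_add)
  moreover have "(\<Sum>n. x ^ n) = 1 / (1 - x)" using x by (intro suminf_geometric) auto
  ultimately show ?thesis using s by (simp add: sums_iff)
qed

lemma rising_factorial_powser_sums:
  fixes x :: real
  assumes x: "0 \<le> x" "x < 1"
  shows "(\<lambda>n. (real n + 1) * x ^ n) sums (1 / (1 - x)\<^sup>2)"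
    and "(\<lambda>n. (real n + 1) * (real n + 2) / 2 * x ^ n) sums (1 / (1 - x) ^ 3)"
    and "(\<lambda>n. (real n + 1) * (real n + 2) * (real n + 3) / 6 * x ^ n) sums (1 / (1 - x) ^ 4)"
proof -
  have 0: "(\<lambda>n. 1 * x ^ n) sums (1 / (1 - x))" using geometric_sums[of x] x by simp
  have s1: "(\<Sum>i\<le>n. 1) = real n + 1" for n by simp
  have s2: "(\<Sum>i\<le>n. real i + 1) = (real n + 1) * (real n + 2) / 2" for n
    by (induction n) (simp_all add: field_simps)
  have s3: "(\<Sum>i\<le>n. (real i + 1) * (real i + 2) / 2) = (real n + 1) * (real n + 2) * (real n + 3) / 6" for n
    by (induction n) (simp_all add: field_simps)
  show 1: "(\<lambda>n. (real n + 1) * x ^ n) sums (1 / (1 - x)\<^sup>2)"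
    using sums_partial_sums_powser[OF x _ 0] unfolding s1 by (simp add: power2_eq_square)
  show 2: "(\<lambda>n. (real n + 1) * (real n + 2) / 2 * x ^ n) sums (1 / (1 - x) ^ 3)"
    using sums_partial_sums_powser[OF x _ 1] unfolding s2 by (simp add: power_numeral_reduce mult.commute)
  show "(\<lambda>n. (real n + 1) * (real n + 2) * (real n + 3) / 6 * x ^ n) sums (1 / (1 - x) ^ 4)"
    using sums_partial_sums_powser[OF x _ 2] unfolding s3 by (simp add: power_numeral_reduce mult.commute)
qed

definition radius_poly :: "real \<Rightarrow> real \<Rightarrow> real" where
  "radius_poly \<alpha> r = 2 * (1 - \<alpha>) * (1 - r) ^ 4 + \<alpha> * (1 - r)\<^sup>2 - (r\<^sup>2 + r + 1)"

lemma radius_poly_strict_antimono: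
  assumes "0 \<le> \<alpha>" "\<alpha> < 1" "0 \<le> x" "x < y" "y \<le> 1"
  shows "radius_poly \<alpha> y < radius_poly \<alpha> x"
proof -
  have "(1 - y) ^ 4 \<le> (1 - x) ^ 4" "(1 - y)\<^sup>2 \<le> (1 - x)\<^sup>2" "x\<^sup>2 \<le> y\<^sup>2"
    using assms by (intro power_mono; simp)+
  then have "2 * (1 - \<alpha>) * (1 - y) ^ 4 \<le> 2 * (1 - \<alpha>) * (1 - x) ^ 4" "\<alpha> * (1 - y)\<^sup>2 \<le> \<alpha> * (1 - x)\<^sup>2"
    using assms by (intro mult_left_mono; simp)+
  then show ?thesis unfolding radius_poly_def using \<open>x\<^sup>2 \<le> y\<^sup>2\<close> \<open>x < y\<close> by linarith
qed

lemma radius_root_iff: "radius_root \<alpha> r \<longleftrightarrow> 0 < r \<and> r < 1 \<and> radius_poly \<alpha> r = 0"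
  by (simp add: radius_root_def radius_poly_def)

lemma radius_root_ex1:
  assumes "0 \<le> \<alpha>" "\<alpha> < 1"
  shows "\<exists>!r. radius_root \<alpha> r"
proof -
  have ends: "radius_poly \<alpha> 0 > 0" "radius_poly \<alpha> 1 < 0" using assms by (simp_all add: radius_poly_def)
  have "continuous_on {0..1} (radius_poly \<alpha>)"
    unfolding radius_poly_def[abs_def] by (intro continuous_intros)
  then obtain r where r: "0 \<le> r" "r \<le> 1" "radius_poly \<alpha> r = 0"
    using IVT2'[of "radius_poly \<alpha>" 1 0 0] ends by auto
  then have "r \<noteq> 0" "r \<noteq> 1" using ends by auto
  then have root: "radius_root \<alpha> r" using r by (simp add: radius_root_iff)
  show ?thesis
  proof (rule ex1I[where a = r], rule root)
    fix s assume "radius_root \<alpha> s"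
    then show "s = r" using root radius_poly_strict_antimono[OF assms, of r s]
        radius_poly_strict_antimono[OF assms, of s r] by (force simp: radius_root_iff)
  qed
qed

lemma radius_root_r0: "0 \<le> \<alpha> \<Longrightarrow> \<alpha> < 1 \<Longrightarrow> radius_root \<alpha> (r0 \<alpha>)"
  unfolding r0_def using radius_root_ex1 by (rule theI')

lemma r0_bounds: "0 \<le> \<alpha> \<Longrightarrow> \<alpha> < 1 \<Longrightarrow> 0 < r0 \<alpha>" "0 \<le> \<alpha> \<Longrightarrow> \<alpha> < 1 \<Longrightarrow> r0 \<alpha> < 1"
  using radius_root_r0 by (auto simp: radius_root_iff)

lemma radius_root_iff_r0: "0 \<le> \<alpha> \<Longrightarrow> \<alpha> < 1 \<Longrightarrow> radius_root \<alpha> r \<longleftrightarrow> r = r0 \<alpha>"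
  using radius_root_ex1 radius_root_r0 by blast

lemma radius_root_0:
  "radius_root 0 r \<longleftrightarrow> 0 < r \<and> r < 1 \<and> 2 * r ^ 4 - 8 * r ^ 3 + 11 * r\<^sup>2 - 9 * r + 1 = 0"
proof -
  have "radius_poly 0 r = 2 * r ^ 4 - 8 * r ^ 3 + 11 * r\<^sup>2 - 9 * r + 1"
    unfolding radius_poly_def by algebra
  then show ?thesis by (simp add: radius_root_iff)
qed

lemma r0_0_approx: "\<bar>r0 0 - 0.129831\<bar> \<le> 5 / 10 ^ 7"
proof -
  have root: "0 < r0 0" "r0 0 < 1" "radius_poly 0 (r0 0) = 0"
    using radius_root_r0[of 0] by (auto simp: radius_root_iff)
  have sgn: "radius_poly 0 (1298305 / 10 ^ 7) > 0" "radius_poly 0 (1298315 / 10 ^ 7) < 0"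
    by (simp_all add: radius_poly_def power_numeral_reduce)
  have "1298305 / 10 ^ 7 \<le> r0 0"
  proof (rule ccontr)
    assume "\<not> ?thesis"
    then show False using radius_poly_strict_antimono[of 0 "r0 0" "1298305 / 10 ^ 7"] root sgn by simp
  qed
  moreover have "r0 0 \<le> 1298315 / 10 ^ 7"
  proof (rule ccontr)
    assume "\<not> ?thesis"
    then show False using radius_poly_strict_antimono[of 0 "1298315 / 10 ^ 7" "r0 0"] root sgn by simp
  qed
  ultimately show ?thesis by (intro abs_leI) simp_all
qed

section \<open>Admissible coefficients and the extremal map\<close>

text \<open>
  Both sequences have maximal moduli. On the positive real axis the signs turn every summand
  of \<open>A - \<alpha> f\<close> beyond the linear term negative, so that no cancellation occurs.
\<close>
definition extremal_a :: "nat \<Rightarrow> complex" where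
  "extremal_a n = (if n = 1 then 1 else - of_real (((real n + 1) / 2)\<^sup>2))"

definition extremal_b :: "nat \<Rightarrow> complex" where
  "extremal_b n = of_real (((real n - 1) / 2)\<^sup>2)"

text \<open>
  Padding with zeros below degree two turns the shifted series of the harmonic map into
  ordinary power series, to which termwise differentiation applies directly.
\<close>
definition from2 :: "(nat \<Rightarrow> complex) \<Rightarrow> nat \<Rightarrow> complex" where
  "from2 a n = (if n < 2 then 0 else a n)"

lemma coeffs_admissible_extremal: "coeffs_admissible extremal_a extremal_b"
  by (auto simp: coeffs_admissible_def extremal_a_def extremal_b_def norm_power norm_divide simp del: of_real_add of_real_diff of_real_divide of_real_power)

text \<open>
  Valid also for divergent series, since the two sides have the same sums; hence the
  harmonic map agrees with a perturbation of the identity everywhere.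
\<close>

lemma suminf_shift_zeros:
  fixes f :: "nat \<Rightarrow> complex"
  assumes "\<And>i. i < k \<Longrightarrow> f i = 0"
  shows "(\<Sum>n. f (n + k)) = suminf f"
proof -
  have "(sums) (\<lambda>n. f (n + k)) = (sums) f"
    by (rule ext) (rule sums_zero_iff_shift[OF assms])
  then show ?thesis by (simp add: suminf_def)
qed

lemma harmonic_map_eq_perturbed_id:
  assumes "coeffs_admissible a b"
  shows "harmonic_map a b = perturbed_id (from2 a) (from2 b)"
proof
  fix z
  have "cmod (b 1) \<le> 0" using assms unfolding coeffs_admissible_def by (metis diff_self div_0 nat_1_eq_mult_iff of_nat_1 order_refl zero_power2)
  then have b1: "b 1 = 0" by simp
  have "(\<Sum>n. from2 a (n + 2) * z ^ (n + 2)) = powser (from2 a) z"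
    by (rule suminf_shift_zeros) (simp add: from2_def)
  moreover have "(\<Sum>n. from2 b (n + 1) * z ^ (n + 1)) = powser (from2 b) z"
    by (rule suminf_shift_zeros) (simp add: from2_def)
  moreover have "from2 b (n + 1) = b (n + 1)" for n using b1 by (cases n) (auto simp: from2_def)
  moreover have "from2 a (n + 2) = a (n + 2)" for n by (simp add: from2_def)
  ultimately show "harmonic_map a b z = perturbed_id (from2 a) (from2 b) z"
    by (simp add: harmonic_map_def h_series_def g_series_def perturbed_id_def)
qed

definition max_weight :: "real \<Rightarrow> nat \<Rightarrow> real" where
  "max_weight \<alpha> n = (if n < 2 then 0 else real n * ((real n)\<^sup>2 + 1) / 2 - \<alpha> * real n)"

lemma max_weight_extremal: "weight \<alpha> (from2 extremal_a) (from2 extremal_b) n = max_weight \<alpha> n"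
  by (auto simp: weight_def from2_def extremal_a_def extremal_b_def max_weight_def norm_power norm_divide
      simp del: of_real_add of_real_diff of_real_divide of_real_power)
    (simp add: field_simps power2_eq_square)

lemma weight_le_max_weight:
  assumes "0 \<le> \<alpha>" "\<alpha> < 1" "coeffs_admissible a b"
  shows "weight \<alpha> (from2 a) (from2 b) n \<le> max_weight \<alpha> n"
proof (cases "n < 2")
  case False
  have "weight \<alpha> (from2 a) (from2 b) n = (real n - \<alpha>) * cmod (a n) + (real n + \<alpha>) * cmod (b n)"
    using False by (simp add: weight_def from2_def)
  also have "\<dots> \<le> (real n - \<alpha>) * ((real n + 1) / 2)\<^sup>2 + (real n + \<alpha>) * ((real n - 1) / 2)\<^sup>2"
    using assms False by (intro add_mono mult_left_mono) (auto simp: coeffs_admissible_def)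
  also have "\<dots> = max_weight \<alpha> n"
    using False by (simp add: max_weight_def field_simps power2_eq_square)
  finally show ?thesis .
qed (simp add: weight_def from2_def max_weight_def)

text \<open>
  With \<open>n = m + 1\<close> the coefficient decomposes as
  \<open>n (n\<^sup>2 + 1) / 2 - \<alpha> n = 3 C(m + 3, 3) - 3 C(m + 2, 2) + (1 - \<alpha>) (m + 1)\<close>, a combination of the
  coefficients of \<open>1 / (1 - r) ^ 4\<close>, \<open>1 / (1 - r) ^ 3\<close> and \<open>1 / (1 - r)\<^sup>2\<close>. The term for \<open>n = 1\<close> is
  subtracted because the identity is not part of the perturbation.
\<close>

lemma max_weight_sums:
  assumes r: "0 \<le> r" "r < 1"
  shows "(\<lambda>n. max_weight \<alpha> n * r ^ n) sums ((1 - \<alpha>) * r - r * radius_poly \<alpha> r / (1 - r) ^ 4)"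
proof -
  have "(\<lambda>m. r * (3 * ((real m + 1) * (real m + 2) * (real m + 3) / 6 * r ^ m)
        - 3 * ((real m + 1) * (real m + 2) / 2 * r ^ m) + (1 - \<alpha>) * ((real m + 1) * r ^ m))
        - (if m = 0 then (1 - \<alpha>) * r else 0))
      sums (r * (3 * (1 / (1 - r) ^ 4) - 3 * (1 / (1 - r) ^ 3) + (1 - \<alpha>) * (1 / (1 - r)\<^sup>2)) - (1 - \<alpha>) * r)"
    using sums_single[of 0 "\<lambda>_. (1 - \<alpha>) * r"]
    by (intro sums_diff sums_add sums_mult rising_factorial_powser_sums r) (simp add: eq_commute)
  moreover have "r * (3 * ((real m + 1) * (real m + 2) * (real m + 3) / 6 * r ^ m)
        - 3 * ((real m + 1) * (real m + 2) / 2 * r ^ m) + (1 - \<alpha>) * ((real m + 1) * r ^ m))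
        - (if m = 0 then (1 - \<alpha>) * r else 0) = max_weight \<alpha> (Suc m) * r ^ Suc m" for m
  proof (cases m)
    case 0 then show ?thesis by (simp add: max_weight_def algebra_simps)
  next
    case (Suc k)
    then show ?thesis by (simp add: max_weight_def field_simps power2_eq_square)
  qed
  ultimately have "(\<lambda>m. max_weight \<alpha> (Suc m) * r ^ Suc m) sums
      (r * (3 * (1 / (1 - r) ^ 4) - 3 * (1 / (1 - r) ^ 3) + (1 - \<alpha>) * (1 / (1 - r)\<^sup>2)) - (1 - \<alpha>) * r)"
    by simp
  then have "(\<lambda>n. max_weight \<alpha> n * r ^ n) sums
      (r * (3 * (1 / (1 - r) ^ 4) - 3 * (1 / (1 - r) ^ 3) + (1 - \<alpha>) * (1 / (1 - r)\<^sup>2)) - (1 - \<alpha>) * r)"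
    by (subst (asm) sums_Suc_iff) (simp add: max_weight_def)
  moreover have "r * (3 * (1 / (1 - r) ^ 4) - 3 * (1 / (1 - r) ^ 3) + (1 - \<alpha>) * (1 / (1 - r)\<^sup>2)) - (1 - \<alpha>) * r
      = (1 - \<alpha>) * r - r * radius_poly \<alpha> r / (1 - r) ^ 4"
  proof -
    define t where "t = 1 - r"
    have t: "t \<noteq> 0" "r = 1 - t" using r by (auto simp: t_def)
    show ?thesis unfolding radius_poly_def t_def[symmetric] unfolding t(2) using t(1)
      by (simp add: field_simps power_numeral_reduce)
  qed
  ultimately show ?thesis by (simp only:)
qed

lemma weighted_coeffs_admissible:
  assumes \<alpha>: "0 \<le> \<alpha>" "\<alpha> < 1" and ab: "coeffs_admissible a b"
  shows "weighted_coeffs \<alpha> 1 (from2 a) (from2 b)"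
proof
  fix r :: real assume r: "0 < r" "r < 1"
  show "summable (\<lambda>n. weight \<alpha> (from2 a) (from2 b) n * r ^ n)"
  proof (rule summable_comparison_test')
    show "summable (\<lambda>n. max_weight \<alpha> n * r ^ n)" using max_weight_sums[of r] r by (auto simp: sums_iff)
    have "0 \<le> weight \<alpha> (from2 a) (from2 b) n" for n
      using \<alpha> by (auto simp: weight_def from2_def)
    then show "norm (weight \<alpha> (from2 a) (from2 b) n * r ^ n) \<le> max_weight \<alpha> n * r ^ n" for n
      using weight_le_max_weight[OF \<alpha> ab] r by (simp add: abs_mult mult_right_mono)
  qed
qed (use \<alpha> in \<open>auto simp: from2_def\<close>)

lemma small_coeffs_admissible:
  assumes \<alpha>: "0 \<le> \<alpha>" "\<alpha> < 1" and ab: "coeffs_admissible a b"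
  shows "small_coeffs \<alpha> (r0 \<alpha>) (from2 a) (from2 b)"
proof -
  interpret weighted_coeffs \<alpha> 1 "from2 a" "from2 b" by (rule weighted_coeffs_admissible[OF assms])
  show ?thesis
  proof
    fix r assume r: "0 < r" "r < r0 \<alpha>"
    then have r1: "r < 1" using r0_bounds[OF \<alpha>] by simp
    show sm: "summable (\<lambda>n. weight \<alpha> (from2 a) (from2 b) n * r ^ n)"
      using summable_weight r r1 by simp
    have "radius_poly \<alpha> r > 0"
      using radius_poly_strict_antimono[OF \<alpha>, of r "r0 \<alpha>"] r radius_root_r0[OF \<alpha>] by (simp add: radius_root_iff)
    then have "r * radius_poly \<alpha> r / (1 - r) ^ 4 > 0" using r r1 by simp
    moreover have "(\<Sum>n. weight \<alpha> (from2 a) (from2 b) n * r ^ n) \<le> (1 - \<alpha>) * r - r * radius_poly \<alpha> r / (1 - r) ^ 4"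
      using r r1 by (intro sums_le[OF _ summable_sums[OF sm] max_weight_sums] mult_right_mono
          weight_le_max_weight[OF assms]) auto
    ultimately show "(\<Sum>n. weight \<alpha> (from2 a) (from2 b) n * r ^ n) < (1 - \<alpha>) * r" by linarith
  qed (use \<alpha> zero in auto)
qed

text \<open>
  At the real point \<open>r0 \<alpha>\<close> the conjugation is invisible and \<open>A - \<alpha> f\<close> equals \<open>(1 - \<alpha>) r\<close> minus the full
  majorant, which at the root is exactly \<open>(1 - \<alpha>) r\<close>.
\<close>

lemma extremal_angular_part:
  assumes \<alpha>: "0 \<le> \<alpha>" "\<alpha> < 1"
  defines "a \<equiv> from2 extremal_a" and "b \<equiv> from2 extremal_b"
  shows "angular_part a b (of_real (r0 \<alpha>)) = of_real \<alpha> * perturbed_id a b (of_real (r0 \<alpha>))"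
proof -
  interpret weighted_coeffs \<alpha> 1 a b
    unfolding a_def b_def by (rule weighted_coeffs_admissible[OF \<alpha> coeffs_admissible_extremal])
  define r where "r = r0 \<alpha>"
  define z where "z = complex_of_real r"
  have r: "0 < r" "r < 1" using r0_bounds[OF \<alpha>] by (auto simp: r_def)
  have z: "cmod z < 1" using r by (simp add: z_def)
  note sa = summable_sums[OF summable_powser(1)[OF z]]
  note sb = summable_sums[OF summable_powser(2)[OF z]]
  have na: "(\<lambda>n. of_nat n * a n * z ^ n) sums powser (\<lambda>n. of_nat n * a n) z"
    using mult_powser_diffs_sums[OF z summable_powser(1)] by (simp add: sums_iff)
  have nb: "(\<lambda>n. of_nat n * b n * z ^ n) sums powser (\<lambda>n. of_nat n * b n) z"
    using mult_powser_diffs_sums[OF z summable_powser(2)] by (simp add: sums_iff)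
  have real: "a n = - of_real (cmod (a n))" "b n = of_real (cmod (b n))" for n
    by (auto simp: a_def b_def from2_def extremal_a_def extremal_b_def norm_power norm_divide
      simp del: of_real_add of_real_diff of_real_divide of_real_power)
  have cb: "cnj (powser b z) = powser b z" and cnb: "cnj (powser (\<lambda>n. of_nat n * b n) z) = powser (\<lambda>n. of_nat n * b n) z"
  proof -
    have "cnj (b n) = b n" for n by (subst (1 2) real(2)) simp
    then have "cnj (b n * z ^ n) = b n * z ^ n" "cnj (of_nat n * b n * z ^ n) = of_nat n * b n * z ^ n" for n
      by (simp_all add: z_def)
    then show "cnj (powser b z) = powser b z" "cnj (powser (\<lambda>n. of_nat n * b n) z) = powser (\<lambda>n. of_nat n * b n) z"
      using sb nb sums_cnj[of _ "powser b z"] sums_cnj[of _ "powser (\<lambda>n. of_nat n * b n) z"]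
      by (metis (no_types, lifting) ext sums_unique2)+
  qed
  have "(\<lambda>n. (of_nat n * a n * z ^ n - of_nat n * b n * z ^ n) - of_real \<alpha> * (a n * z ^ n + b n * z ^ n))
    sums ((powser (\<lambda>n. of_nat n * a n) z - powser (\<lambda>n. of_nat n * b n) z) - of_real \<alpha> * (powser a z + powser b z))"
    by (intro sums_diff sums_mult sums_add sa sb na nb)
  moreover have "(of_nat n * a n * z ^ n - of_nat n * b n * z ^ n) - of_real \<alpha> * (a n * z ^ n + b n * z ^ n)
      = of_real (- (max_weight \<alpha> n * r ^ n))" for n
  proof -
    have "(of_nat n * a n * z ^ n - of_nat n * b n * z ^ n) - of_real \<alpha> * (a n * z ^ n + b n * z ^ n)
      = of_real (- (weight \<alpha> a b n * r ^ n))"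
      by (subst (1 2) real(1), subst (1 2) real(2)) (simp add: z_def weight_def algebra_simps)
    then show ?thesis using max_weight_extremal by (simp add: a_def b_def)
  qed
  moreover have "(\<lambda>n. complex_of_real (- (max_weight \<alpha> n * r ^ n))) sums of_real (- ((1 - \<alpha>) * r))"
    using max_weight_sums[of r \<alpha>] r radius_root_r0[OF \<alpha>]
    by (intro sums_of_real sums_minus) (simp add: radius_root_iff r_def)
  ultimately have eq: "(powser (\<lambda>n. of_nat n * a n) z - powser (\<lambda>n. of_nat n * b n) z) - of_real \<alpha> * (powser a z + powser b z)
      = of_real (- ((1 - \<alpha>) * r))"
    by (simp only: sums_unique2)
  have alg: "z + X - Y = of_real \<alpha> * (z + U + V)" if "(X - Y) - of_real \<alpha> * (U + V) = of_real (- ((1 - \<alpha>) * r))" for X Y U V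
    using that by (simp add: z_def algebra_simps)
  show ?thesis unfolding r_def[symmetric] z_def[symmetric] angular_part_def perturbed_id_def cb cnb
    by (rule alg[OF eq])
qed

text \<open>
  A larger disk contains the circle of radius \<open>r0 \<alpha>\<close>, on which the angular speed at \<open>\<theta> = 0\<close> is
  \<open>\<alpha>\<close> and hence not greater than \<open>\<alpha>\<close>.
\<close>

lemma not_fully_starlike_extremal:
  assumes \<alpha>: "0 \<le> \<alpha>" "\<alpha> < 1" and "\<rho> > r0 \<alpha>"
  shows "\<not> fully_starlike_of_order \<alpha> (harmonic_map extremal_a extremal_b) \<rho>"
proof
  let ?a = "from2 extremal_a" and ?b = "from2 extremal_b"
  interpret weighted_coeffs \<alpha> 1 ?a ?b
    by (rule weighted_coeffs_admissible[OF \<alpha> coeffs_admissible_extremal])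
  let ?f = "perturbed_id ?a ?b" and ?r = "r0 \<alpha>"
  assume "fully_starlike_of_order \<alpha> (harmonic_map extremal_a extremal_b) \<rho>"
  then obtain \<phi> where br: "arg_branch_on_circle ?f ?r \<phi>"
    and \<phi>: "\<forall>\<theta>\<in>{0..2 * pi}. \<exists>d > \<alpha>. (\<phi> has_real_derivative d) (at \<theta>)"
    using r0_bounds(1)[OF \<alpha>] \<open>\<rho> > ?r\<close>
    unfolding harmonic_map_eq_perturbed_id[OF coeffs_admissible_extremal] fully_starlike_of_order_def by blast
  from \<phi> obtain d where d: "d > \<alpha>" "(\<phi> has_real_derivative d) (at 0)"
    by (metis atLeastAtMost_iff order_refl pi_ge_zero mult_nonneg_nonneg zero_le_numeral)
  have vel: "((\<lambda>t. ?f (circ ?r t)) has_vector_derivative \<i> * angular_part ?a ?b (circ ?r 0)) (at 0)"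
    using r0_bounds[OF \<alpha>] by (intro circle_velocity[OF summable_powser]) auto
  have "?f (circ ?r 0) \<noteq> 0" using br unfolding arg_branch_on_circle_def by blast
  moreover have "d = Im (\<i> * angular_part ?a ?b (circ ?r 0) / ?f (circ ?r 0))"
    by (rule arg_branch_speed[OF br d(2) vel])
  ultimately show False using extremal_angular_part[OF \<alpha>] d(1) by simp
qed

theorem theorem4p2:
  shows
    "(\<forall>\<alpha>::real. 0 \<le> \<alpha> \<and> \<alpha> < 1 \<longrightarrow>
        (\<exists>!r. radius_root \<alpha> r) \<and>
        (\<forall>a b. coeffs_admissible a b \<longrightarrow>
           inj_on (harmonic_map a b) (ball 0 (r0 \<alpha>)) \<and>
           fully_starlike_of_order \<alpha> (harmonic_map a b) (r0 \<alpha>)) \<and>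
        (\<forall>\<rho> > r0 \<alpha>. \<exists>a b. coeffs_admissible a b \<and>
           \<not> fully_starlike_of_order \<alpha> (harmonic_map a b) \<rho>)) \<and>
     (\<forall>a b. coeffs_admissible a b \<longrightarrow>
        inj_on (harmonic_map a b) (ball 0 (r0 0)) \<and>
        fully_starlike (harmonic_map a b) (r0 0)) \<and>
     (\<forall>r::real. 0 < r \<and> r < 1 \<longrightarrow>
        (2 * r ^ 4 - 8 * r ^ 3 + 11 * r\<^sup>2 - 9 * r + 1 = 0 \<longleftrightarrow> r = r0 0)) \<and>
     \<bar>r0 0 - 0.129831\<bar> \<le> 5 / 10 ^ 7"
proof -
  have pos: "inj_on (harmonic_map a b) (ball 0 (r0 \<alpha>)) \<and> fully_starlike_of_order \<alpha> (harmonic_map a b) (r0 \<alpha>)"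
    if "0 \<le> \<alpha>" "\<alpha> < 1" "coeffs_admissible a b" for \<alpha> a b
    using small_coeffs.inj_on_perturbed_id[OF small_coeffs_admissible[OF that]]
      small_coeffs.fully_starlike_perturbed_id[OF small_coeffs_admissible[OF that]]
    by (simp only: harmonic_map_eq_perturbed_id[OF that(3)] simp_thms)
  have quartic: "2 * r ^ 4 - 8 * r ^ 3 + 11 * r\<^sup>2 - 9 * r + 1 = 0 \<longleftrightarrow> r = r0 0" if "0 < r \<and> r < 1" for r :: real
    using radius_root_0[of r] radius_root_iff_r0[of 0 r] that by simp
  have sharp: "\<exists>a b. coeffs_admissible a b \<and> \<not> fully_starlike_of_order \<alpha> (harmonic_map a b) \<rho>"
    if "0 \<le> \<alpha>" "\<alpha> < 1" "\<rho> > r0 \<alpha>" for \<alpha> \<rho>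
    using coeffs_admissible_extremal not_fully_starlike_extremal[OF that] by blast
  have pos_0: "inj_on (harmonic_map a b) (ball 0 (r0 0)) \<and> fully_starlike (harmonic_map a b) (r0 0)"
    if "coeffs_admissible a b" for a b
    by (rule pos) (use that in auto)
  show ?thesis
    by (intro conjI allI impI; (elim conjE)?;
        (rule r0_0_approx | rule quartic conjunct1[OF pos] conjunct2[OF pos] conjunct1[OF pos_0] conjunct2[OF pos_0]
          radius_root_ex1 sharp; blast))
qed

end
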